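(* Let $\alpha_1,\alpha_2,\lambda_1,\lambda_2\in(0,\infty)$, and let $X\sim\mathrm{TSD}(\alpha_{1},0,\lambda_{1};\alpha_{1},0,\lambda_{1})$ and $Y\sim\mathrm{TSD}(\alpha_{2},0,\lambda_{2};\alpha_{2},0,\lambda_{2})$. Then, for $\lambda_{1}>1$, $$d_{W_{3}}(Y,X)\leq\frac{\lambda_{1}^{2}}{\lambda_{1}^{2}-1}\left(\left|\frac{\alpha_{1}}{\lambda_{1}^{2}}-\frac{\alpha_{2}}{\lambda_{2}^{2}}\right|+2\left(1+\frac{\alpha_1}{3\lambda_1}\right)\left|\frac{1}{\lambda_{1}^{2}}-\frac{1}{\lambda_{2}^{2}}\right|\right).$$
   Context: For $\alpha,\lambda\in(0,\infty)$, $\mathrm{TSD}(\alpha,0,\lambda;\alpha,0,\lambda)$ denotes the (symmetric tempered stable) distribution with characteristic function $\exp\left(\int_{\mathbb{R}}(e^{izu}-1)\frac{\alpha}{|u|}e^{-\lambda|u|}\,du\right)$, $z\in\mathbb{R}$. For an integer $r\ge1$, $\mathcal{H}_r$ is the set of $r$ times differentiable functions $h:\mathbb{R}\to\mathbb{R}$ with $\sup_{x}|h^{(k)}(x)|\le 1$ for $k=0,1,\ldots,r$ (with $h^{(0)}=h$), and for random variables $Y,Z$, $d_{W_r}(Y,Z):=\sup_{h\in\mathcal{H}_r}|\mathbb{E}[h(Y)]-\mathbb{E}[h(Z)]|$. *)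

theory Defs
  imports "HOL-Probability.Probability"
begin

text \<open>The integrand below is \<open>O(1)\<close> near \<open>u = 0\<close> and decays exponentially, so the Lebesgue integral
  converges absolutely whenever \<open>lam > 0\<close>.\<close>

definition sym_TSD_char :: "real \<Rightarrow> real \<Rightarrow> real \<Rightarrow> complex" where
  "sym_TSD_char \<alpha> lam z =
     exp (CLINT u|lborel. (iexp (z * u) - 1) * complex_of_real (\<alpha> / \<bar>u\<bar> * exp (- lam * \<bar>u\<bar>)))"

text \<open>The random variable \<open>X\<close> on the probability space \<open>M\<close> has law
  \<open>TSD(\<alpha>, 0, lam; \<alpha>, 0, lam)\<close>.\<close>

definition has_sym_TSD :: "'a measure \<Rightarrow> ('a \<Rightarrow> real) \<Rightarrow> real \<Rightarrow> real \<Rightarrow> bool" where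
  "has_sym_TSD M X \<alpha> lam \<longleftrightarrow>
     X \<in> borel_measurable M \<and>
     (\<forall>z. char (distr M borel X) z = sym_TSD_char \<alpha> lam z)"

text \<open>Since \<^const>\<open>deriv\<close> is total, existence of the derivatives is required separately. The
  condition \<open>sup \<bar>h\<^sup>(\<^sup>k\<^sup>)\<bar> \<le> 1\<close> is stated pointwise because a real-valued supremum of an unbounded
  set is unspecified.\<close>

definition smooth_test_functions :: "nat \<Rightarrow> (real \<Rightarrow> real) set" where
  "smooth_test_functions r =
     {h. (\<forall>k<r. \<forall>x. ((deriv ^^ k) h) differentiable (at x)) \<and>
         (\<forall>k\<le>r. \<forall>x. \<bar>(deriv ^^ k) h x\<bar> \<le> 1)}"

text \<open>The two random variables may live on different probability spaces; only their laws matter.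
  The supremum is over a nonempty set bounded by \<open>2\<close>, so it is a genuine real supremum.\<close>

definition smooth_wasserstein ::
    "nat \<Rightarrow> 'a measure \<Rightarrow> ('a \<Rightarrow> real) \<Rightarrow> 'b measure \<Rightarrow> ('b \<Rightarrow> real) \<Rightarrow> real" where
  "smooth_wasserstein r M Y N Z =
     (SUP h\<in>smooth_test_functions r.
        \<bar>(LINT \<omega>|M. h (Y \<omega>)) - (LINT \<omega>|N. h (Z \<omega>))\<bar>)"

end

theory Submission
  imports Defs
begin

text \<open>Both laws are infinitely divisible with Levy densities \<open>f\<^sub>i(u) = \<alpha>\<^sub>i exp(-\<lambda>\<^sub>i\<bar>u\<bar>) / \<bar>u\<bar>\<close>. Each is a weak
  limit of \<open>m\<close>-fold convolution powers of laws \<open>(1 - p) \<delta>\<^sub>0 + f\<^sub>i(u) du / m\<close>, the density being truncated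
  to \<open>\<bar>u\<bar> > \<epsilon>\<close>; exchanging the \<open>m\<close> factors one by one gives
  \<open>\<bar>E h(X) - E h(Y)\<bar> \<le> sup\<^sub>x \<bar>\<integral> (h(x + u) - h(x)) (f\<^sub>1 - f\<^sub>2)(u) du\<bar>\<close>.
  Symmetrising and substituting \<open>u = v / \<lambda>\<^sub>i\<close> turns the generator of \<open>f\<^sub>i\<close> into
  \<open>(\<alpha>\<^sub>i / \<lambda>\<^sub>i\<^sup>2) \<integral> v exp(-v) q(v / \<lambda>\<^sub>i) dv\<close> over \<open>v > 0\<close>, where
  \<open>q(r) = (h(x + r) + h(x - r) - 2 h(x)) / r\<^sup>2\<close> satisfies \<open>\<bar>q\<bar> \<le> 1\<close> and is Lipschitz with constant \<open>1/3\<close>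
  when the second and third derivatives of \<open>h\<close> are bounded by \<open>1\<close>. Hence the distance is at most
  \<open>\<bar>\<alpha>\<^sub>1/\<lambda>\<^sub>1\<^sup>2 - \<alpha>\<^sub>2/\<lambda>\<^sub>2\<^sup>2\<bar> + (2/3) (\<alpha>\<^sub>1/\<lambda>\<^sub>1\<^sup>2) \<bar>1/\<lambda>\<^sub>1 - 1/\<lambda>\<^sub>2\<bar>\<close>, which is below the stated bound.\<close>

section \<open>Convolution powers\<close>

lemma real_distribution_convolution:
  assumes "real_distribution M" "real_distribution N"
  shows "real_distribution (M \<star> N)"
proof -
  interpret M: real_distribution M by fact
  interpret N: real_distribution N by fact
  interpret P: pair_prob_space M N ..
  show ?thesis
    unfolding convolution_def by (rule P.real_distribution_distr) measurable
qed

text \<open>Fubini in both orders. With the second factor innermost, an estimate on the remaining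
  power is averaged over the first factor; the swapped order averages an estimate on the first
  factor alone.\<close>

lemma
  fixes g :: "real \<Rightarrow> 'a::{banach, second_countable_topology}"
  assumes "real_distribution M" "real_distribution N"
    and [measurable]: "g \<in> borel_measurable borel" and bdd: "\<And>x. norm (g x) \<le> B"
  shows integral_convolution: "(LINT x|(M \<star> N). g x) = (LINT x|M. LINT y|N. g (x + y))"
    and integral_convolution_swap: "(LINT x|(M \<star> N). g x) = (LINT y|N. LINT x|M. g (x + y))"
proof -
  interpret M: real_distribution M by fact
  interpret N: real_distribution N by fact
  interpret P: pair_prob_space M N ..
  have int: "integrable (M \<Otimes>\<^sub>M N) (\<lambda>(x, y). g (x + y))"
    by (rule P.integrable_const_bound[where B = B]) (auto simp: bdd)
  have eq: "(LINT x|(M \<star> N). g x) = integral\<^sup>L (M \<Otimes>\<^sub>M N) (\<lambda>(x, y). g (x + y))"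
    unfolding convolution_def by (subst integral_distr) (auto simp: case_prod_unfold)
  show "(LINT x|(M \<star> N). g x) = (LINT x|M. LINT y|N. g (x + y))"
    unfolding eq by (rule P.integral_fst[OF int, symmetric])
  show "(LINT x|(M \<star> N). g x) = (LINT y|N. LINT x|M. g (x + y))"
    unfolding eq by (rule P.integral_snd[OF int, symmetric])
qed

lemma char_convolution:
  assumes "real_distribution M" "real_distribution N"
  shows "char (M \<star> N) t = char M t * char N t"
proof -
  have "char (M \<star> N) t = (LINT x|M. LINT y|N. iexp (t * (x + y)))"
    unfolding char_def by (rule integral_convolution[OF assms, where B = 1]) simp_all
  also have "\<dots> = (LINT x|M. LINT y|N. iexp (t * x) * iexp (t * y))"
    by (simp add: distrib_left exp_add)
  finally show ?thesis
    unfolding char_def by simp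
qed

primrec conv_power :: "real measure \<Rightarrow> nat \<Rightarrow> real measure" where
  "conv_power M 0 = return borel 0"
| "conv_power M (Suc n) = (M \<star> conv_power M n)"

lemma real_distribution_conv_power:
  assumes "real_distribution M"
  shows "real_distribution (conv_power M n)"
proof (induction n)
  case 0
  show ?case
    unfolding real_distribution_def real_distribution_axioms_def by (simp add: prob_space_return)
qed (simp add: real_distribution_convolution assms)

lemma char_conv_power:
  assumes "real_distribution M"
  shows "char (conv_power M n) t = char M t ^ n"
proof (induction n)
  case 0
  show ?case by (simp add: char_def integral_return)
qed (simp add: char_convolution assms real_distribution_conv_power)

text \<open>Lindeberg's replacement argument: the factors are exchanged one at a time, each exchange
  costing at most \<open>\<delta>\<close> because convolution only averages over translates of \<open>h\<close>.\<close>

lemma conv_power_integral_diff_le: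
  fixes h :: "real \<Rightarrow> real"
  assumes M: "real_distribution M" and N: "real_distribution N"
    and [measurable]: "h \<in> borel_measurable borel" and bdd: "\<And>x. \<bar>h x\<bar> \<le> B"
    and step: "\<And>x. \<bar>(LINT u|M. h (x + u)) - (LINT u|N. h (x + u))\<bar> \<le> \<delta>"
  shows "\<bar>(LINT u|conv_power M n. h (x + u)) - (LINT u|conv_power N n. h (x + u))\<bar> \<le> n * \<delta>"
proof (induction n arbitrary: x)
  case 0
  show ?case by (simp add: integral_return)
next
  case (Suc n)
  let ?Mn = "conv_power M n" and ?Nn = "conv_power N n"
  note Mn = real_distribution_conv_power[OF M, of n] and Nn = real_distribution_conv_power[OF N, of n]
  interpret M: real_distribution M by fact
  interpret N: real_distribution N by fact
  interpret Mn: real_distribution ?Mn by fact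
  interpret Nn: real_distribution ?Nn by fact
  have bint: "integrable P (\<lambda>u. LINT v|Q. h (x + (u + v)))"
    if "real_distribution P" "real_distribution Q" for P Q
  proof -
    interpret P: real_distribution P by fact
    interpret Q: real_distribution Q by fact
    have "0 \<le> B" using bdd[of 0] by simp
    have "\<bar>LINT v|Q. h (x + (u + v))\<bar> \<le> B" for u
    proof -
      have "\<bar>LINT v|Q. h (x + (u + v))\<bar> \<le> (LINT v|Q. \<bar>h (x + (u + v))\<bar>)"
        by (rule integral_abs_bound)
      also have "\<dots> \<le> (LINT v|Q. B)"
        by (intro integral_mono Q.integrable_const_bound[where B = B]) (auto simp: bdd \<open>0 \<le> B\<close>)
      finally show ?thesis by (simp add: Q.prob_space del: Q.space_eq_univ)
    qed
    then show ?thesis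
      by (intro P.integrable_const_bound[where B = B]) auto
  qed
  have swapeq: "(LINT v|Q. h (x + (u + v))) = (LINT v|Q. h (x + u + v))" for u Q
    by (simp add: add.assoc)
  have M1: "(LINT u|(M \<star> ?Mn). h (x + u)) = (LINT u|M. LINT v|?Mn. h (x + (u + v)))"
    by (rule integral_convolution[OF M Mn, where B = B]) (auto simp: bdd)
  \<comment> \<open>The mixed law \<open>M \<star> ?Nn\<close> lies between the two powers and is
    unfolded in opposite orders. Against \<open>M \<star> ?Mn\<close> only the tail differs, so the
    induction hypothesis applies at \<open>x + u\<close>; against \<open>N \<star> ?Nn\<close> only
    the first factor differs, so \<open>step\<close> applies.\<close>
  have MN1: "(LINT u|(M \<star> ?Nn). h (x + u)) = (LINT u|M. LINT v|?Nn. h (x + (u + v)))"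
    by (rule integral_convolution[OF M Nn, where B = B]) (auto simp: bdd)
  have MN2: "(LINT u|(M \<star> ?Nn). h (x + u)) = (LINT v|?Nn. LINT u|M. h (x + (v + u)))"
    by (subst integral_convolution_swap[OF M Nn, where B = B]) (auto simp: bdd add.commute)
  have N2: "(LINT u|(N \<star> ?Nn). h (x + u)) = (LINT v|?Nn. LINT u|N. h (x + (v + u)))"
    by (subst integral_convolution_swap[OF N Nn, where B = B]) (auto simp: bdd add.commute)
  have avg: "\<bar>(LINT u|P. F u) - (LINT u|P. G u)\<bar> \<le> c"
    if P: "real_distribution P" and F: "integrable P F" and G: "integrable P G"
      and le: "\<And>u. \<bar>F u - G u\<bar> \<le> c" for P F G and c :: real
  proof -
    interpret P: real_distribution P by fact
    have "\<bar>(LINT u|P. F u) - (LINT u|P. G u)\<bar> = \<bar>LINT u|P. F u - G u\<bar>"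
      using F G by simp
    also have "\<dots> \<le> (LINT u|P. \<bar>F u - G u\<bar>)"
      by (rule integral_abs_bound)
    also have "\<dots> \<le> (LINT u|P. c)"
      using F G le by (intro integral_mono) auto
    finally show ?thesis by (simp add: P.prob_space del: P.space_eq_univ)
  qed
  have "\<bar>(LINT u|(M \<star> ?Mn). h (x + u)) - (LINT u|(M \<star> ?Nn). h (x + u))\<bar> \<le> n * \<delta>"
    unfolding M1 MN1
    by (intro avg M bint Mn Nn) (use Suc.IH in \<open>simp add: swapeq\<close>)
  moreover have "\<bar>(LINT u|(M \<star> ?Nn). h (x + u)) - (LINT u|(N \<star> ?Nn). h (x + u))\<bar> \<le> \<delta>"
    unfolding N2 MN2
    by (intro avg M bint N Nn) (use step in \<open>simp add: swapeq\<close>)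
  ultimately show ?case
    by (simp add: algebra_simps)
qed

text \<open>The law \<open>(1 - p) \<delta>\<^sub>0 + F(u) du\<close> with \<open>p = \<integral> F\<close>, for \<open>F\<close> vanishing on \<open>{-e..e}\<close>: the missing mass
  is spread uniformly over that interval, which is then collapsed to the origin.\<close>

definition jump_law :: "real \<Rightarrow> (real \<Rightarrow> real) \<Rightarrow> real measure" where
  "jump_law e F = distr
     (density lborel (\<lambda>u. F u + (1 - (LINT v|lborel. F v)) / (2 * e) * indicator {-e..e} u))
     borel (\<lambda>u. if \<bar>u\<bar> \<le> e then 0 else u)"

context
  fixes e :: real and F :: "real \<Rightarrow> real"
  assumes e: "0 < e" and F_int: "integrable lborel F" and F_nonneg: "\<And>u. 0 \<le> F u"
    and F_0: "\<And>u. \<bar>u\<bar> \<le> e \<Longrightarrow> F u = 0" and mass: "(LINT u|lborel. F u) \<le> 1"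
begin

lemma jump_density_nonneg:
  "0 \<le> F u + (1 - (LINT v|lborel. F v)) / (2 * e) * indicator {-e..e} u"
  using e mass F_nonneg[of u] by (simp add: divide_nonneg_pos)

lemma jump_part_measurable [measurable]: "F \<in> borel_measurable borel"
  using F_int by (auto dest: borel_measurable_integrable)

lemma has_bochner_integral_indicator_scaleR:
  "has_bochner_integral lborel (\<lambda>u. indicator {-e..e} u *\<^sub>R (c :: 'a :: {banach, second_countable_topology})) ((2 * e) *\<^sub>R c)"
  using has_bochner_integral_indicator[of "{-e..e}" lborel c] e by simp

lemma real_distribution_jump_law: "real_distribution (jump_law e F)"
proof -
  let ?d = "\<lambda>u. F u + (1 - (LINT v|lborel. F v)) / (2 * e) * indicator {-e..e} u"
  have ind: "has_bochner_integral lborel (indicator {-e..e} :: real \<Rightarrow> real) (2 * e)"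
    using has_bochner_integral_indicator_scaleR[of "1::real"] by simp
  have d: "has_bochner_integral lborel ?d
      ((LINT v|lborel. F v) + (1 - (LINT v|lborel. F v)) / (2 * e) * (2 * e))"
    by (intro has_bochner_integral_add has_bochner_integral_integrable F_int
        has_bochner_integral_mult_right ind)
  have "(\<integral>\<^sup>+ u. ?d u \<partial>lborel) = ennreal (LINT u|lborel. ?d u)"
    using d jump_density_nonneg
    by (intro nn_integral_eq_integral) (auto dest: integrable.intros)
  also have "(LINT u|lborel. ?d u) = 1"
    using has_bochner_integral_integral_eq[OF d] e by simp
  finally have "prob_space (density lborel (\<lambda>u. ennreal (?d u)))"
    by (intro prob_spaceI) (simp add: emeasure_density)
  then show ?thesis
    unfolding jump_law_def by (rule prob_space.real_distribution_distr) simp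
qed

text \<open>The collapse sends the uniform part to 0, where it contributes
  \<open>(1 - p) * g 0\<close>, and does not affect \<open>F\<close>, which vanishes on the
  collapsed interval. Subtracting \<open>g 0\<close> inside the integral absorbs the term
  \<open>- p * g 0\<close>.\<close>

lemma integral_jump_law:
  fixes g :: "real \<Rightarrow> 'a::{banach, second_countable_topology}"
  assumes [measurable]: "g \<in> borel_measurable borel" and bdd: "\<And>x. norm (g x) \<le> B"
  shows "(LINT u|jump_law e F. g u) = g 0 + (LINT u|lborel. F u *\<^sub>R (g u - g 0))"
proof -
  let ?p = "LINT v|lborel. F v"
  have Fg: "integrable lborel (\<lambda>u. F u *\<^sub>R g u)"
  proof (rule Bochner_Integration.integrable_bound)
    show "integrable lborel (\<lambda>u. F u * B)" using F_int by simp
    have "0 \<le> B" using bdd[of 0] norm_ge_zero order_trans by blast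
    then show "AE u in lborel. norm (F u *\<^sub>R g u) \<le> norm (F u * B)"
      using bdd F_nonneg by (auto intro!: mult_left_mono)
  qed simp
  have *: "(F u + (1 - ?p) / (2 * e) * indicator {-e..e} u) *\<^sub>R g (if \<bar>u\<bar> \<le> e then 0 else u)
      = F u *\<^sub>R g u + ((1 - ?p) / (2 * e)) *\<^sub>R (indicator {-e..e} u *\<^sub>R g 0)" for u
    using F_0[of u] by (auto simp: indicator_def abs_le_iff algebra_simps)
  have "has_bochner_integral lborel
      (\<lambda>u. F u *\<^sub>R g u + ((1 - ?p) / (2 * e)) *\<^sub>R (indicator {-e..e} u *\<^sub>R g 0))
      ((LINT u|lborel. F u *\<^sub>R g u) + ((1 - ?p) / (2 * e)) *\<^sub>R ((2 * e) *\<^sub>R g 0))"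
    by (intro has_bochner_integral_add has_bochner_integral_integrable Fg
        has_bochner_integral_scaleR_right has_bochner_integral_indicator_scaleR)
  note eq = has_bochner_integral_integral_eq[OF this]
  have "(LINT u|jump_law e F. g u)
      = (LINT u|lborel. (F u + (1 - ?p) / (2 * e) * indicator {-e..e} u) *\<^sub>R g (if \<bar>u\<bar> \<le> e then 0 else u))"
    unfolding jump_law_def
    by (subst integral_distr, simp, simp, subst integral_density) (use jump_density_nonneg in auto)
  also have "\<dots> = (LINT u|lborel. F u *\<^sub>R g u) + (1 - ?p) *\<^sub>R g 0"
    unfolding * eq using e by simp
  also have "(LINT u|lborel. F u *\<^sub>R (g u - g 0)) = (LINT u|lborel. F u *\<^sub>R g u) - ?p *\<^sub>R g 0"
    using Fg F_int by (simp add: scaleR_diff_right)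
  ultimately show ?thesis
    by (simp add: scaleR_diff_left)
qed

end

section \<open>Truncated Levy densities\<close>

text \<open>The limit \<open>exp \<psi>\<close> is itself the power of
  \<open>b n = exp (\<psi> / (n + 1))\<close>. Both bases lie in the closed unit disc, so the powers
  differ by at most \<open>n + 1\<close> times the difference of the bases, and that product tends
  to 0.\<close>

lemma tendsto_one_plus_power_exp:
  fixes c :: "nat \<Rightarrow> complex"
  assumes c: "c \<longlonglongrightarrow> \<psi>" and \<psi>: "Re \<psi> \<le> 0" and le1: "\<And>n. norm (1 + c n / of_nat (Suc n)) \<le> 1"
  shows "(\<lambda>n. (1 + c n / of_nat (Suc n)) ^ Suc n) \<longlonglongrightarrow> exp \<psi>"
proof -
  define b where "b n = exp (\<psi> / of_nat (Suc n))" for n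
  have b_pow: "b n ^ Suc n = exp \<psi>" for n
    unfolding b_def by (subst exp_of_nat_mult[symmetric]) (simp del: of_nat_Suc)
  have b_le1: "norm (b n) \<le> 1" for n
    using \<psi> by (simp add: b_def divide_nonpos_pos del: of_nat_Suc)
  \<comment> \<open>The difference quotient of \<open>exp (z * \<psi>)\<close> at 0, taken along
    \<open>z = 1 / (n + 1)\<close>, shows that \<open>(n + 1) * (b n - 1)\<close> tends to
    \<open>\<psi>\<close>.\<close>
  have "((\<lambda>z. exp (z * \<psi>)) has_field_derivative \<psi>) (at 0)"
    by (auto intro!: derivative_eq_intros)
  then have "((\<lambda>z. (exp (z * \<psi>) - 1) / z) \<longlongrightarrow> \<psi>) (at 0)"
    by (simp add: has_field_derivative_iff)
  moreover have "filterlim (\<lambda>n. inverse (of_nat (Suc n)) :: complex) (at 0) sequentially"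
    unfolding filterlim_at
    using LIMSEQ_Suc[OF lim_inverse_n[where 'a = complex]] by (simp add: inverse_eq_divide del: of_nat_Suc)
  ultimately have "(\<lambda>n. (exp (inverse (of_nat (Suc n)) * \<psi>) - 1) / inverse (of_nat (Suc n))) \<longlonglongrightarrow> \<psi>"
    by (rule filterlim_compose)
  then have "(\<lambda>n. of_nat (Suc n) * (b n - 1)) \<longlonglongrightarrow> \<psi>"
    by (simp add: b_def divide_inverse mult_ac del: of_nat_Suc)
  from tendsto_diff[OF c this] have lim: "(\<lambda>n. norm (c n - of_nat (Suc n) * (b n - 1))) \<longlonglongrightarrow> 0"
    by (simp add: tendsto_norm_zero_iff)
  have bound: "norm ((1 + c n / of_nat (Suc n)) ^ Suc n - exp \<psi>) \<le> norm (c n - of_nat (Suc n) * (b n - 1))" for n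
  proof -
    have "norm ((1 + c n / of_nat (Suc n)) ^ Suc n - exp \<psi>) \<le> Suc n * norm (1 + c n / of_nat (Suc n) - b n)"
      using norm_power_diff[OF le1 b_le1, of n "Suc n" n] unfolding b_pow .
    also have "\<dots> = norm (of_nat (Suc n) * (1 + c n / of_nat (Suc n) - b n))"
      by (simp add: norm_mult del: of_nat_Suc)
    also have "of_nat (Suc n) * (1 + c n / of_nat (Suc n) - b n) = c n - of_nat (Suc n) * (b n - 1)"
      by (simp add: field_simps del: of_nat_Suc)
    finally show ?thesis .
  qed
  have "(\<lambda>n. (1 + c n / of_nat (Suc n)) ^ Suc n - exp \<psi>) \<longlonglongrightarrow> 0"
    by (rule Lim_null_comparison[OF _ lim]) (use bound in auto)
  then show ?thesis
    by (simp add: LIM_zero_iff)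
qed

definition trunc :: "real \<Rightarrow> nat \<Rightarrow> real \<Rightarrow> real" where
  "trunc K n = indicator {u. K / sqrt (Suc n) < \<bar>u\<bar>}"

text \<open>One factor of the approximating convolution power, which has \<open>Suc n\<close>
  factors; the successor keeps the divisor positive.\<close>

definition levy_step :: "real \<Rightarrow> (real \<Rightarrow> real) \<Rightarrow> nat \<Rightarrow> real measure" where
  "levy_step K f n = jump_law (K / sqrt (Suc n)) (\<lambda>u. trunc K n u * f u / Suc n)"

lemma trunc_measurable [measurable]: "trunc K n \<in> borel_measurable borel"
  unfolding trunc_def by measurable

lemma trunc_bounds: "0 \<le> trunc K n u" "trunc K n u \<le> 1"
  by (auto simp: trunc_def)

lemma tendsto_trunc:
  assumes "u \<noteq> 0"
  shows "(\<lambda>n. trunc K n u) \<longlonglongrightarrow> 1"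
proof -
  have "filterlim (\<lambda>n. sqrt (real (Suc n))) at_top sequentially"
    by (rule filterlim_compose[OF sqrt_at_top filterlim_compose[OF filterlim_real_sequentially filterlim_Suc]])
  then have "(\<lambda>n. K / sqrt (Suc n)) \<longlonglongrightarrow> 0"
    by (intro tendsto_divide_0[OF tendsto_const] filterlim_at_top_imp_at_infinity)
  then have "eventually (\<lambda>n. K / sqrt (Suc n) < \<bar>u\<bar>) sequentially"
    using assms by (intro order_tendstoD(2)) auto
  then have "eventually (\<lambda>n. trunc K n u = 1) sequentially"
    by eventually_elim (simp add: trunc_def)
  then show ?thesis
    by (rule tendsto_eventually)
qed

text \<open>A Levy density with \<open>\<integral> \<bar>u\<bar> f(u) du \<le> K\<close>. Truncating at \<open>K / sqrt m\<close> leaves mass at most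
  \<open>sqrt m \<le> m\<close>, so dividing by \<open>m\<close> gives a subprobability.\<close>

locale levy_density =
  fixes f :: "real \<Rightarrow> real" and K :: real
  assumes meas [measurable]: "f \<in> borel_measurable borel" and nonneg: "\<And>u. 0 \<le> f u"
    and moment_int: "integrable lborel (\<lambda>u. \<bar>u\<bar> * f u)"
    and K_pos: "0 < K" and moment_le: "(LINT u|lborel. \<bar>u\<bar> * f u) \<le> K"
begin

text \<open>A Markov-type bound: where the cutoff equals 1, the factor
  \<open>sqrt (Suc n) / K * \<bar>u\<bar>\<close> is at least 1. Integrated, it controls the
  truncated mass by the first absolute moment.\<close>

lemma trunc_le: "trunc K n u * f u \<le> sqrt (Suc n) / K * (\<bar>u\<bar> * f u)"
proof (cases "K / sqrt (Suc n) < \<bar>u\<bar>")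
  case True
  then have "1 \<le> sqrt (Suc n) / K * \<bar>u\<bar>"
    using K_pos by (simp add: field_simps)
  from mult_right_mono[OF this nonneg[of u]] True show ?thesis
    by (simp add: trunc_def mult_ac)
next
  case False
  then show ?thesis
    using K_pos nonneg[of u] by (simp add: trunc_def)
qed

lemma trunc_int: "integrable lborel (\<lambda>u. trunc K n u * f u)"
proof (rule Bochner_Integration.integrable_bound)
  show "integrable lborel (\<lambda>u. sqrt (Suc n) / K * (\<bar>u\<bar> * f u))"
    using moment_int by (rule integrable_mult_right)
  show "AE u in lborel. norm (trunc K n u * f u) \<le> norm (sqrt (Suc n) / K * (\<bar>u\<bar> * f u))"
    using trunc_le[of n] trunc_bounds(1)[of K n] nonneg K_pos by (auto simp: abs_mult)
qed simp

lemma trunc_mass: "(LINT u|lborel. trunc K n u * f u / Suc n) \<le> 1"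
proof -
  have "(LINT u|lborel. trunc K n u * f u) \<le> (LINT u|lborel. sqrt (Suc n) / K * (\<bar>u\<bar> * f u))"
    by (intro integral_mono trunc_int integrable_mult_right moment_int trunc_le)
  also have "\<dots> \<le> sqrt (Suc n) / K * K"
    unfolding integral_mult_right_zero by (intro mult_left_mono moment_le) (use K_pos in auto)
  also have "\<dots> \<le> Suc n"
    using K_pos by (simp add: real_le_lsqrt power2_eq_square)
  finally show ?thesis
    by (simp del: of_nat_Suc)
qed

text \<open>These are the hypotheses of the context of \<open>jump_law\<close>; the remaining one,
  on the mass, is \<open>trunc_mass\<close>.\<close>

lemma jump_conditions:
  "0 < K / sqrt (Suc n)"
  "integrable lborel (\<lambda>u. trunc K n u * f u / Suc n)"
  "0 \<le> trunc K n u * f u / Suc n"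
  "\<bar>u\<bar> \<le> K / sqrt (Suc n) \<Longrightarrow> trunc K n u * f u / Suc n = 0"
  using K_pos trunc_int[of n] nonneg[of u] trunc_bounds(1)[of K n u]
  by (auto simp: trunc_def simp del: of_nat_Suc)

lemma real_distribution_levy_step: "real_distribution (levy_step K f n)"
  unfolding levy_step_def by (intro real_distribution_jump_law jump_conditions trunc_mass)

lemma integral_levy_step:
  fixes g :: "real \<Rightarrow> 'a::{banach, second_countable_topology}"
  assumes "g \<in> borel_measurable borel" "\<And>x. norm (g x) \<le> B"
  shows "(LINT u|levy_step K f n. g u)
    = g 0 + (LINT u|lborel. (trunc K n u * f u) *\<^sub>R (g u - g 0)) /\<^sub>R Suc n"
proof -
  have "(LINT u|levy_step K f n. g u) = g 0 + (LINT u|lborel. (trunc K n u * f u / Suc n) *\<^sub>R (g u - g 0))"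
    unfolding levy_step_def by (intro integral_jump_law[where B = B] jump_conditions trunc_mass assms)
  also have "(\<lambda>u. (trunc K n u * f u / Suc n) *\<^sub>R (g u - g 0))
      = (\<lambda>u. inverse (Suc n) *\<^sub>R ((trunc K n u * f u) *\<^sub>R (g u - g 0)))"
    by (simp add: divide_inverse mult_ac)
  finally show ?thesis
    by (simp only: integral_scaleR_right)
qed

text \<open>The Levy-Khintchine exponent without compensator, convergent because
  \<open>\<bar>u\<bar> * f u\<close> is integrable.\<close>

abbreviation exponent :: "real \<Rightarrow> complex" where
  "exponent z \<equiv> (LINT u|lborel. (iexp (z * u) - 1) * complex_of_real (f u))"

lemma norm_exponent_integrand_le:
  "norm ((iexp (z * u) - 1) * complex_of_real (f u)) \<le> \<bar>z\<bar> * (\<bar>u\<bar> * f u)"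
proof -
  have "norm (iexp (z * u) - 1) \<le> \<bar>z * u\<bar>"
    using iexp_approx1[of "z * u" 0] by simp
  from mult_right_mono[OF this nonneg[of u]] show ?thesis
    using nonneg[of u] by (simp add: norm_mult abs_mult mult_ac)
qed

lemma exponent_integrable: "integrable lborel (\<lambda>u. (iexp (z * u) - 1) * complex_of_real (f u))"
proof (rule Bochner_Integration.integrable_bound)
  show "integrable lborel (\<lambda>u. \<bar>z\<bar> * (\<bar>u\<bar> * f u))"
    using moment_int by (rule integrable_mult_right)
  show "AE u in lborel. norm ((iexp (z * u) - 1) * complex_of_real (f u)) \<le> norm (\<bar>z\<bar> * (\<bar>u\<bar> * f u))"
    using norm_exponent_integrand_le nonneg by (auto simp: abs_mult)
qed simp

text \<open>The real part of the integrand is \<open>(cos (z * u) - 1) * f u\<close>. This sign is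
  what \<open>tendsto_one_plus_power_exp\<close> asks of the limit.\<close>

lemma Re_exponent_le_0: "Re (exponent z) \<le> 0"
proof -
  have "Re (exponent z) = (LINT u|lborel. Re ((iexp (z * u) - 1) * complex_of_real (f u)))"
    using exponent_integrable by (rule integral_Re[symmetric])
  moreover have "0 \<le> (LINT u|lborel. - Re ((iexp (z * u) - 1) * complex_of_real (f u)))"
  proof (rule Bochner_Integration.integral_nonneg)
    show "0 \<le> - Re ((iexp (z * u) - 1) * complex_of_real (f u))" for u
      using mult_right_mono[OF cos_le_one nonneg[of u], of "z * u"]
      by (simp add: Re_exp algebra_simps)
  qed
  ultimately show ?thesis by simp
qed

lemma char_levy_step:
  "char (levy_step K f n) z
    = 1 + (LINT u|lborel. (trunc K n u * f u) *\<^sub>R (iexp (z * u) - 1)) / of_nat (Suc n)"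
  unfolding char_def
  by (subst integral_levy_step[where B = 1]) (simp_all add: scaleR_conv_of_real divide_inverse mult.commute)

text \<open>Dominated convergence removes the truncation from the exponent, and
  \<open>tendsto_one_plus_power_exp\<close> takes the limit of the powers. The bases lie in the unit
  disc because they are values of characteristic functions.\<close>

lemma tendsto_char_conv_power_levy_step:
  "(\<lambda>n. char (conv_power (levy_step K f n) (Suc n)) z) \<longlonglongrightarrow> exp (exponent z)"
proof -
  have "(\<lambda>n. LINT u|lborel. (trunc K n u * f u) *\<^sub>R (iexp (z * u) - 1)) \<longlonglongrightarrow> exponent z"
  proof (rule integral_dominated_convergence[where w = "\<lambda>u. \<bar>z\<bar> * (\<bar>u\<bar> * f u)"])
    show "integrable lborel (\<lambda>u. \<bar>z\<bar> * (\<bar>u\<bar> * f u))"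
      using moment_int by (rule integrable_mult_right)
    show "AE u in lborel. (\<lambda>n. (trunc K n u * f u) *\<^sub>R (iexp (z * u) - 1))
        \<longlonglongrightarrow> (iexp (z * u) - 1) * complex_of_real (f u)"
    proof (rule AE_I2)
      fix u :: real
      show "(\<lambda>n. (trunc K n u * f u) *\<^sub>R (iexp (z * u) - 1)) \<longlonglongrightarrow> (iexp (z * u) - 1) * complex_of_real (f u)"
      \<comment> \<open>At the origin the cutoff does not tend to 1, but the factor
        \<open>iexp (z * u) - 1\<close> vanishes.\<close>
      proof (cases "u = 0")
        case False
        have "(\<lambda>n. (trunc K n u * f u) *\<^sub>R (iexp (z * u) - 1)) \<longlonglongrightarrow> (1 * f u) *\<^sub>R (iexp (z * u) - 1)"
          by (intro tendsto_intros tendsto_trunc False)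
        then show ?thesis by (simp add: scaleR_conv_of_real mult.commute)
      qed simp
    qed
    show "AE u in lborel. norm ((trunc K n u * f u) *\<^sub>R (iexp (z * u) - 1)) \<le> \<bar>z\<bar> * (\<bar>u\<bar> * f u)" for n
    proof (rule AE_I2)
      fix u :: real
      have "norm ((trunc K n u * f u) *\<^sub>R (iexp (z * u) - 1))
          = trunc K n u * norm ((iexp (z * u) - 1) * complex_of_real (f u))"
        using trunc_bounds(1)[of K n u] by (simp add: norm_mult abs_mult mult_ac)
      also have "\<dots> \<le> 1 * norm ((iexp (z * u) - 1) * complex_of_real (f u))"
        by (intro mult_right_mono trunc_bounds) simp
      finally show "norm ((trunc K n u * f u) *\<^sub>R (iexp (z * u) - 1)) \<le> \<bar>z\<bar> * (\<bar>u\<bar> * f u)"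
        using norm_exponent_integrand_le[of z u] by simp
    qed
  qed simp_all
  moreover have "norm (char (levy_step K f n) z) \<le> 1" for n
    by (rule real_distribution.cmod_char_le_1[OF real_distribution_levy_step])
  ultimately show ?thesis
    unfolding char_conv_power[OF real_distribution_levy_step] char_levy_step
    by (intro tendsto_one_plus_power_exp Re_exponent_le_0)
qed

text \<open>Levy's continuity theorem turns convergence of characteristic functions into weak
  convergence, which is then tested on bounded continuous \<open>h\<close>.\<close>

lemma tendsto_integral_conv_power_levy_step:
  fixes h :: "real \<Rightarrow> real"
  assumes P: "real_distribution P" "\<And>z. char P z = exp (exponent z)"
    and "\<And>x. isCont h x" "\<And>x. \<bar>h x\<bar> \<le> B"
  shows "(\<lambda>n. LINT u|conv_power (levy_step K f n) (Suc n). h u) \<longlonglongrightarrow> (LINT u|P. h u)"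
proof -
  have rd: "real_distribution (conv_power (levy_step K f n) (Suc n))" for n
    by (intro real_distribution_conv_power real_distribution_levy_step)
  have "weak_conv_m (\<lambda>n. conv_power (levy_step K f n) (Suc n)) P"
    by (intro levy_continuity rd P(1)) (use tendsto_char_conv_power_levy_step P(2) in simp)
  with rd P(1) assms(3,4) show ?thesis
    by (intro weak_conv_imp_integral_bdd_continuous_conv[where B = B]) auto
qed

end

section \<open>Comparison of two laws through their generators\<close>

text \<open>The replacement argument is run on the two approximating powers, which share their
  cutoff because \<open>K\<close> is common. Exchanging one factor costs at most
  \<open>(G + r n) / (n + 1)\<close>, where \<open>r n\<close> bounds the truncation error. All
  \<open>n + 1\<close> exchanges cost \<open>G + r n\<close>, which tends to \<open>G\<close>, while
  the integrals converge weakly.\<close>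

lemma levy_density_integral_diff_le:
  fixes h :: "real \<Rightarrow> real"
  assumes f1: "levy_density f1 K" and f2: "levy_density f2 K"
    and P: "real_distribution P" "\<And>z. char P z = exp (levy_density.exponent f1 z)"
    and Q: "real_distribution Q" "\<And>z. char Q z = exp (levy_density.exponent f2 z)"
    and bdd: "\<And>x. \<bar>h x\<bar> \<le> B" and lip: "\<And>x y. \<bar>h x - h y\<bar> \<le> L * \<bar>x - y\<bar>"
    and gen: "\<And>x. \<bar>(LINT u|lborel. f1 u * (h (x + u) - h x)) - (LINT u|lborel. f2 u * (h (x + u) - h x))\<bar> \<le> G"
  shows "\<bar>(LINT u|P. h u) - (LINT u|Q. h u)\<bar> \<le> G"
proof -
  interpret f1: levy_density f1 K by fact
  interpret f2: levy_density f2 K by fact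
  have "0 \<le> L" using order_trans[OF abs_ge_zero lip[of 0 1]] by simp
  then have "L-lipschitz_on UNIV h"
    by (intro lipschitz_onI) (auto simp: dist_real_def lip)
  then have cont: "continuous_on UNIV h"
    by (rule lipschitz_on_continuous_on)
  then have isCont: "isCont h x" for x
    by (simp add: continuous_on_eq_continuous_at)
  have [measurable]: "h \<in> borel_measurable borel"
    using cont by (rule borel_measurable_continuous_onI)
  \<comment> \<open>By the Lipschitz property of \<open>h\<close>, this integral dominates the parts
    of the two generators that are cut off near 0; it vanishes in the limit by dominated
    convergence.\<close>
  define r where "r n = (LINT u|lborel. (1 - trunc K n u) * (L * (\<bar>u\<bar> * f1 u + \<bar>u\<bar> * f2 u)))" for n
  have w_int: "integrable lborel (\<lambda>u. L * (\<bar>u\<bar> * f1 u + \<bar>u\<bar> * f2 u))"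
    using f1.moment_int f2.moment_int by simp
  have w_nonneg: "0 \<le> L * (\<bar>u\<bar> * f1 u + \<bar>u\<bar> * f2 u)" for u
    using \<open>0 \<le> L\<close> f1.nonneg[of u] f2.nonneg[of u] by simp
  have w_trunc: "norm ((1 - trunc K n u) * (L * (\<bar>u\<bar> * f1 u + \<bar>u\<bar> * f2 u))) \<le> L * (\<bar>u\<bar> * f1 u + \<bar>u\<bar> * f2 u)" for n u
    using w_nonneg[of u] by (simp add: trunc_def indicator_def)
  have r_int: "integrable lborel (\<lambda>u. (1 - trunc K n u) * (L * (\<bar>u\<bar> * f1 u + \<bar>u\<bar> * f2 u)))" for n
    by (rule Bochner_Integration.integrable_bound[OF w_int])
       (use w_trunc w_nonneg in \<open>auto simp del: norm_mult\<close>)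
  have "r \<longlonglongrightarrow> integral\<^sup>L (lborel :: real measure) (\<lambda>_. 0)"
    unfolding r_def
  proof (rule integral_dominated_convergence[where w = "\<lambda>u. L * (\<bar>u\<bar> * f1 u + \<bar>u\<bar> * f2 u)"])
    show "AE u in lborel. (\<lambda>n. (1 - trunc K n u) * (L * (\<bar>u\<bar> * f1 u + \<bar>u\<bar> * f2 u))) \<longlonglongrightarrow> 0"
    proof (rule AE_I2)
      fix u :: real
      show "(\<lambda>n. (1 - trunc K n u) * (L * (\<bar>u\<bar> * f1 u + \<bar>u\<bar> * f2 u))) \<longlonglongrightarrow> 0"
      proof (cases "u = 0")
        case False
        have "(\<lambda>n. (1 - trunc K n u) * (L * (\<bar>u\<bar> * f1 u + \<bar>u\<bar> * f2 u)))
            \<longlonglongrightarrow> (1 - 1) * (L * (\<bar>u\<bar> * f1 u + \<bar>u\<bar> * f2 u))"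
          by (intro tendsto_intros tendsto_trunc False)
        then show ?thesis by simp
      qed simp
    qed
  qed (use w_trunc w_int in \<open>simp_all del: norm_mult real_norm_def\<close>)
  then have r_lim: "r \<longlonglongrightarrow> 0" by simp

  have gen_int: "integrable lborel (\<lambda>u. f u * (h (x + u) - h x))"
    and trunc_gen_int: "integrable lborel (\<lambda>u. trunc K n u * f u * (h (x + u) - h x))"
    if "levy_density f K" for f x n
  proof -
    interpret f: levy_density f K by fact
    have le: "norm (f u * (h (x + u) - h x)) \<le> L * (\<bar>u\<bar> * f u)" for u
      using mult_right_mono[OF lip[of "x + u" x] f.nonneg[of u]] f.nonneg[of u]
      by (simp add: abs_mult mult_ac)
    have int: "integrable lborel (\<lambda>u. L * (\<bar>u\<bar> * f u))"
      using f.moment_int by simp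
    show gi: "integrable lborel (\<lambda>u. f u * (h (x + u) - h x))"
      by (rule Bochner_Integration.integrable_bound[OF int])
        (use le in \<open>auto intro: order_trans[OF _ abs_ge_self]\<close>)
    show "integrable lborel (\<lambda>u. trunc K n u * f u * (h (x + u) - h x))"
    proof (rule Bochner_Integration.integrable_bound[OF gi])
      show "AE u in lborel. norm (trunc K n u * f u * (h (x + u) - h x)) \<le> norm (f u * (h (x + u) - h x))"
        by (auto simp: trunc_def indicator_def)
    qed simp
  qed

  have step: "\<bar>(LINT u|levy_step K f1 n. h (x + u)) - (LINT u|levy_step K f2 n. h (x + u))\<bar> \<le> (G + r n) / Suc n"
    for n x
  proof -
    let ?g1 = "\<lambda>u. f1 u * (h (x + u) - h x)" and ?g2 = "\<lambda>u. f2 u * (h (x + u) - h x)"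
    let ?t1 = "\<lambda>u. trunc K n u * f1 u * (h (x + u) - h x)" and ?t2 = "\<lambda>u. trunc K n u * f2 u * (h (x + u) - h x)"
    note ints = gen_int[OF f1, of x] gen_int[OF f2, of x] trunc_gen_int[OF f1, of n x] trunc_gen_int[OF f2, of n x]
    \<comment> \<open>The full generator difference minus the truncated one, so that
      \<open>gen\<close> together with a bound on the integral of \<open>?d\<close> controls the
      truncated difference.\<close>
    let ?d = "\<lambda>u. (?g1 u - ?g2 u) - (?t1 u - ?t2 u)"
    have d_int: "integrable lborel ?d" using ints by simp
    have d_le: "\<bar>?d u\<bar> \<le> (1 - trunc K n u) * (L * (\<bar>u\<bar> * f1 u + \<bar>u\<bar> * f2 u))" for u
    proof -
      have "?d u = (1 - trunc K n u) * ((f1 u - f2 u) * (h (x + u) - h x))"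
        by (simp add: algebra_simps)
      moreover have "\<bar>(f1 u - f2 u) * (h (x + u) - h x)\<bar> \<le> (f1 u + f2 u) * (L * \<bar>u\<bar>)"
        unfolding abs_mult using lip[of "x + u" x] f1.nonneg[of u] f2.nonneg[of u]
        by (intro mult_mono) auto
      ultimately have "\<bar>?d u\<bar> \<le> (1 - trunc K n u) * ((f1 u + f2 u) * (L * \<bar>u\<bar>))"
        using trunc_bounds[of K n u] by (simp only: abs_mult[of "1 - trunc K n u"] abs_of_nonneg mult_left_mono)
      then show ?thesis
        by (simp add: algebra_simps)
    qed
    have "\<bar>LINT u|lborel. ?d u\<bar> \<le> (LINT u|lborel. \<bar>?d u\<bar>)"
      by (rule integral_abs_bound)
    also have "\<dots> \<le> r n"
      unfolding r_def by (rule integral_mono[OF integrable_abs[OF d_int] r_int d_le])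
    finally have d_bound: "\<bar>LINT u|lborel. ?d u\<bar> \<le> r n" .
    have "(LINT u|lborel. ?d u) = ((LINT u|lborel. ?g1 u) - (LINT u|lborel. ?g2 u))
        - ((LINT u|lborel. ?t1 u) - (LINT u|lborel. ?t2 u))"
      using ints by simp
    with d_bound gen[of x] have tr: "\<bar>(LINT u|lborel. ?t1 u) - (LINT u|lborel. ?t2 u)\<bar> \<le> G + r n"
      by linarith
    have eq: "(LINT u|levy_step K f n. h (x + u))
        = h x + (LINT u|lborel. trunc K n u * f u * (h (x + u) - h x)) / Suc n" if "levy_density f K" for f
      by (subst levy_density.integral_levy_step[OF that, where B = B]) (simp_all add: bdd divide_inverse mult_ac)
    have "(LINT u|levy_step K f1 n. h (x + u)) - (LINT u|levy_step K f2 n. h (x + u))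
        = ((LINT u|lborel. ?t1 u) - (LINT u|lborel. ?t2 u)) / Suc n"
      unfolding eq[OF f1] eq[OF f2] by (simp add: diff_divide_distrib)
    with tr show ?thesis
      by (simp add: divide_right_mono del: of_nat_Suc)
  qed
  have approx: "\<bar>(LINT u|conv_power (levy_step K f1 n) (Suc n). h u)
      - (LINT u|conv_power (levy_step K f2 n) (Suc n). h u)\<bar> \<le> G + r n" for n
    using conv_power_integral_diff_le[OF f1.real_distribution_levy_step f2.real_distribution_levy_step _ bdd step,
        of n "Suc n" 0]
    by (simp del: conv_power.simps of_nat_Suc)
  have lhs: "(\<lambda>n. \<bar>(LINT u|conv_power (levy_step K f1 n) (Suc n). h u)
      - (LINT u|conv_power (levy_step K f2 n) (Suc n). h u)\<bar>) \<longlonglongrightarrow> \<bar>(LINT u|P. h u) - (LINT u|Q. h u)\<bar>"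
    by (intro tendsto_rabs tendsto_diff
        f1.tendsto_integral_conv_power_levy_step[OF P isCont bdd]
        f2.tendsto_integral_conv_power_levy_step[OF Q isCont bdd])
  have "(\<lambda>n. G + r n) \<longlonglongrightarrow> G + 0"
    by (intro tendsto_intros r_lim)
  from LIMSEQ_le[OF lhs this] approx show ?thesis
    by auto
qed

section \<open>Symmetric second difference quotients\<close>

text \<open>Both \<open>g - f\<close> and \<open>g + f\<close> are nondecreasing on
  \<open>[0, r]\<close> and vanish at 0. Repeated use takes the place of Taylor expansion with
  remainder.\<close>

lemma abs_le_if_abs_deriv_le:
  fixes f g :: "real \<Rightarrow> real"
  assumes f: "\<And>t. (f has_real_derivative f' t) (at t)" and g: "\<And>t. (g has_real_derivative g' t) (at t)"
    and le: "\<And>t. 0 \<le> t \<Longrightarrow> \<bar>f' t\<bar> \<le> g' t" and "f 0 = 0" "g 0 = 0" "0 \<le> r"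
  shows "\<bar>f r\<bar> \<le> g r"
proof -
  have "g 0 - f 0 \<le> g r - f r"
    by (rule DERIV_nonneg_imp_nondecreasing[OF \<open>0 \<le> r\<close>])
      (use DERIV_diff[OF g f] le in \<open>fastforce simp: abs_le_iff\<close>)
  moreover have "g 0 + f 0 \<le> g r + f r"
    by (rule DERIV_nonneg_imp_nondecreasing[OF \<open>0 \<le> r\<close>])
      (use DERIV_add[OF g f] le in \<open>fastforce simp: abs_le_iff\<close>)
  ultimately show ?thesis
    using assms by simp
qed

lemma
  fixes f :: "real \<Rightarrow> real"
  assumes "\<And>x. (f has_real_derivative f' x) (at x)"
  shows DERIV_shift_plus: "((\<lambda>r. f (x + r)) has_real_derivative f' (x + r)) (at r)"
    and DERIV_shift_minus: "((\<lambda>r. f (x - r)) has_real_derivative - f' (x - r)) (at r)"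
proof -
  have "((\<lambda>r. x + r) has_real_derivative 1) (at r)" "((\<lambda>r. x - r) has_real_derivative - 1) (at r)"
    by (auto intro!: derivative_eq_intros)
  from DERIV_chain2[OF assms this(1)] DERIV_chain2[OF assms this(2)]
  show "((\<lambda>r. f (x + r)) has_real_derivative f' (x + r)) (at r)"
    "((\<lambda>r. f (x - r)) has_real_derivative - f' (x - r)) (at r)"
    by simp_all
qed

text \<open>At \<open>r = 0\<close> division by zero yields 0 rather than the second derivative of
  \<open>h\<close>. Hence the size bound holds for every \<open>r\<close>, while the Lipschitz bound
  is stated for positive arguments only.\<close>

definition second_quotient :: "(real \<Rightarrow> real) \<Rightarrow> real \<Rightarrow> real \<Rightarrow> real" where
  "second_quotient h x r = (h (x + r) + h (x - r) - 2 * h x) / r\<^sup>2"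

lemma second_quotient_minus [simp]: "second_quotient h x (- r) = second_quotient h x r"
  by (simp add: second_quotient_def add.commute)

context
  fixes h h1 h2 h3 :: "real \<Rightarrow> real"
  assumes d0: "\<And>x. (h has_real_derivative h1 x) (at x)"
    and d1: "\<And>x. (h1 has_real_derivative h2 x) (at x)"
    and d2: "\<And>x. (h2 has_real_derivative h3 x) (at x)"
    and b2: "\<And>x. \<bar>h2 x\<bar> \<le> 1" and b3: "\<And>x. \<bar>h3 x\<bar> \<le> 1"
begin

lemma shift_derivs:
  "((\<lambda>r. h (x + r)) has_real_derivative h1 (x + r)) (at r)"
  "((\<lambda>r. h (x - r)) has_real_derivative - h1 (x - r)) (at r)"
  "((\<lambda>r. h1 (x + r)) has_real_derivative h2 (x + r)) (at r)"
  "((\<lambda>r. h1 (x - r)) has_real_derivative - h2 (x - r)) (at r)"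
  "((\<lambda>r. h2 (x + r)) has_real_derivative h3 (x + r)) (at r)"
  "((\<lambda>r. h2 (x - r)) has_real_derivative - h3 (x - r)) (at r)"
  by (rule DERIV_shift_plus[OF d0] DERIV_shift_minus[OF d0] DERIV_shift_plus[OF d1] DERIV_shift_minus[OF d1]
      DERIV_shift_plus[OF d2] DERIV_shift_minus[OF d2])+

text \<open>The bound on \<open>h2\<close> is integrated twice from 0: the difference of
  \<open>h1\<close> is at most \<open>2 * r\<close>, and the second difference of \<open>h\<close>
  at most \<open>r\<^sup>2\<close>. Evenness covers negative \<open>r\<close>.\<close>

lemma second_quotient_le_1: "\<bar>second_quotient h x r\<bar> \<le> 1"
proof -
  have *: "\<bar>second_quotient h x r\<bar> \<le> 1" if "0 < r" for r
  proof -
    have h1_le: "\<bar>h1 (x + r) - h1 (x - r)\<bar> \<le> 2 * r" if "0 \<le> r" for r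
    proof (rule abs_le_if_abs_deriv_le[OF _ _ _ _ _ that])
      show "((\<lambda>r. h1 (x + r) - h1 (x - r)) has_real_derivative h2 (x + t) + h2 (x - t)) (at t)" for t
        by (auto intro!: derivative_eq_intros shift_derivs)
      show "((\<lambda>r. 2 * r) has_real_derivative 2) (at t)" for t :: real
        by (auto intro!: derivative_eq_intros)
      show "\<bar>h2 (x + t) + h2 (x - t)\<bar> \<le> 2" for t
        using b2[of "x + t"] b2[of "x - t"] by linarith
    qed simp_all
    have "\<bar>h (x + r) + h (x - r) - 2 * h x\<bar> \<le> r\<^sup>2"
    proof (rule abs_le_if_abs_deriv_le[OF _ _ h1_le _ _ less_imp_le[OF that]])
      show "((\<lambda>r. h (x + r) + h (x - r) - 2 * h x) has_real_derivative h1 (x + t) - h1 (x - t)) (at t)" for t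
        by (auto intro!: derivative_eq_intros shift_derivs)
      show "((\<lambda>r. r\<^sup>2) has_real_derivative 2 * t) (at t)" for t :: real
        by (auto intro!: derivative_eq_intros)
    qed simp_all
    with that show ?thesis
      by (simp add: second_quotient_def abs_divide)
  qed
  consider "0 < r" | "r = 0" | "0 < - r" by linarith
  then show ?thesis
    using *[of r] *[of "- r"] by cases (auto simp: second_quotient_def[of h x 0])
qed

text \<open>The expression inside the absolute value is, for positive \<open>r\<close>,
  \<open>r ^ 3\<close> times the derivative of the quotient. Differentiating twice leaves
  \<open>t * (h3 (x + t) - h3 (x - t))\<close>, of size at most \<open>2 * t\<close>. All
  intermediate terms vanish at 0, so two integrations give \<open>t\<^sup>2\<close> and then
  \<open>r ^ 3 / 3\<close>.\<close>

lemma second_quotient_deriv_numerator_le: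
  assumes "0 \<le> r"
  shows "\<bar>r * (h1 (x + r) - h1 (x - r)) - 2 * (h (x + r) + h (x - r) - 2 * h x)\<bar> \<le> r ^ 3 / 3"
proof (rule abs_le_if_abs_deriv_le[OF _ _ _ _ _ assms])
  show "((\<lambda>r. r * (h1 (x + r) - h1 (x - r)) - 2 * (h (x + r) + h (x - r) - 2 * h x)) has_real_derivative
      t * (h2 (x + t) + h2 (x - t)) - (h1 (x + t) - h1 (x - t))) (at t)" for t
    by (rule derivative_eq_intros shift_derivs refl)+ (simp add: algebra_simps)
  show "((\<lambda>r. r ^ 3 / 3) has_real_derivative t\<^sup>2) (at t)" for t :: real
    by (auto intro!: derivative_eq_intros)
  show "\<bar>t * (h2 (x + t) + h2 (x - t)) - (h1 (x + t) - h1 (x - t))\<bar> \<le> t\<^sup>2" if "0 \<le> t" for t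
  proof (rule abs_le_if_abs_deriv_le[OF _ _ _ _ _ that])
    show "((\<lambda>r. r * (h2 (x + r) + h2 (x - r)) - (h1 (x + r) - h1 (x - r))) has_real_derivative
        t * (h3 (x + t) - h3 (x - t))) (at t)" for t
      by (rule derivative_eq_intros shift_derivs refl)+ (simp add: algebra_simps)
    show "((\<lambda>r. r\<^sup>2) has_real_derivative t * 2) (at t)" for t :: real
      by (auto intro!: derivative_eq_intros)
    show "\<bar>t * (h3 (x + t) - h3 (x - t))\<bar> \<le> t * 2" if "0 \<le> t" for t
      unfolding abs_mult using b3[of "x + t"] b3[of "x - t"] that by (intro mult_mono) auto
  qed simp_all
qed simp_all

text \<open>The previous estimate divided by \<open>r ^ 3\<close> bounds the derivative by 1/3 on
  the convex set of positive reals.\<close>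

lemma second_quotient_lipschitz:
  assumes "0 < r" "0 < t"
  shows "\<bar>second_quotient h x r - second_quotient h x t\<bar> \<le> 1 / 3 * \<bar>r - t\<bar>"
proof -
  let ?N = "\<lambda>r. r * (h1 (x + r) - h1 (x - r)) - 2 * (h (x + r) + h (x - r) - 2 * h x)"
  have "norm (second_quotient h x r - second_quotient h x t) \<le> 1 / 3 * norm (r - t)"
  proof (rule field_differentiable_bound[where S = "{0<..}" and f' = "\<lambda>r. ?N r / r ^ 3"])
    fix r :: real assume r: "r \<in> {0<..}"
    have "(second_quotient h x has_real_derivative ?N r / r ^ 3) (at r)"
      unfolding second_quotient_def [abs_def]
      by (rule derivative_eq_intros shift_derivs refl)+
        (use r in \<open>simp_all add: divide_simps, simp add: algebra_simps eval_nat_numeral\<close>)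
    then show "(second_quotient h x has_real_derivative ?N r / r ^ 3) (at r within {0<..})"
      by (rule has_field_derivative_at_within)
    show "norm (?N r / r ^ 3) \<le> 1 / 3"
      using second_quotient_deriv_numerator_le[of r x] r by (simp add: abs_divide field_simps)
  qed (use assms in auto)
  then show ?thesis by simp
qed

text \<open>With \<open>q1\<close>, \<open>q2\<close> the two quotients,
  \<open>s1 * q1 - s2 * q2 = (s1 - s2) * q2 + s1 * (q1 - q2)\<close>: the size bound handles the
  first summand, the Lipschitz bound the second. Evenness replaces \<open>v\<close> by
  \<open>\<bar>v\<bar>\<close>, and \<open>v \<noteq> 0\<close> keeps both arguments
  positive.\<close>

lemma scaled_second_quotient_diff_le:
  assumes "0 < l1" "0 < l2" "0 \<le> s1" "v \<noteq> 0"
  shows "\<bar>s1 * second_quotient h x (v / l1) - s2 * second_quotient h x (v / l2)\<bar>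
    \<le> \<bar>s1 - s2\<bar> + s1 * \<bar>1 / l1 - 1 / l2\<bar> / 3 * \<bar>v\<bar>"
proof -
  let ?q = "\<lambda>l. second_quotient h x (v / l)"
  have q_abs: "?q l = second_quotient h x (\<bar>v\<bar> / l)" for l
    by (cases "0 \<le> v") simp_all
  have "\<bar>?q l1 - ?q l2\<bar> \<le> 1 / 3 * \<bar>\<bar>v\<bar> / l1 - \<bar>v\<bar> / l2\<bar>"
    unfolding q_abs using assms by (intro second_quotient_lipschitz) auto
  also have "\<bar>v\<bar> / l1 - \<bar>v\<bar> / l2 = \<bar>v\<bar> * (1 / l1 - 1 / l2)"
    by (simp add: algebra_simps)
  finally have lip: "\<bar>?q l1 - ?q l2\<bar> \<le> \<bar>1 / l1 - 1 / l2\<bar> / 3 * \<bar>v\<bar>"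
    by (simp add: abs_mult mult.commute)
  have "\<bar>s1 * ?q l1 - s2 * ?q l2\<bar> = \<bar>(s1 - s2) * ?q l2 + s1 * (?q l1 - ?q l2)\<bar>"
    by (simp add: algebra_simps)
  also have "\<dots> \<le> \<bar>s1 - s2\<bar> * \<bar>?q l2\<bar> + s1 * \<bar>?q l1 - ?q l2\<bar>"
    using abs_triangle_ineq[of "(s1 - s2) * ?q l2" "s1 * (?q l1 - ?q l2)"] assms by (simp add: abs_mult)
  also have "\<dots> \<le> \<bar>s1 - s2\<bar> * 1 + s1 * (\<bar>1 / l1 - 1 / l2\<bar> / 3 * \<bar>v\<bar>)"
    by (intro add_mono mult_left_mono second_quotient_le_1 lip) (use assms in auto)
  finally show ?thesis by simp
qed

end

text \<open>The half-line integral is the Gamma integral for \<open>fact k\<close>, and evenness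
  doubles it. The cases \<open>k = 1\<close> and \<open>k = 2\<close> supply the constants 2 and 4
  of the generator bound.\<close>

lemma has_bochner_integral_abs_power_exp:
  "has_bochner_integral lborel (\<lambda>v. \<bar>v\<bar> ^ k * exp (- \<bar>v\<bar>)) (2 * fact k :: real)"
proof -
  have "has_bochner_integral lborel (\<lambda>v. indicator {0..} v *\<^sub>R (\<bar>v\<bar> ^ k * exp (- \<bar>v\<bar>))) (fact k :: real)"
  proof (rule has_bochner_integral_nn_integral)
    have "(\<integral>\<^sup>+ v. ennreal (indicator {0..} v *\<^sub>R (\<bar>v\<bar> ^ k * exp (- \<bar>v\<bar>))) \<partial>lborel)
        = (\<integral>\<^sup>+ v. ennreal (v ^ k * exp (- v)) * indicator {0..} v \<partial>lborel)"
      by (intro nn_integral_cong) (auto simp: indicator_def)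
    then show "(\<integral>\<^sup>+ v. ennreal (indicator {0..} v *\<^sub>R (\<bar>v\<bar> ^ k * exp (- \<bar>v\<bar>))) \<partial>lborel) = ennreal (fact k)"
      by (simp add: nn_intergal_power_times_exp_Ici)
  qed auto
  from has_bochner_integral_even_function[OF this] show ?thesis
    by simp
qed

section \<open>The symmetric tempered stable law\<close>

text \<open>For \<open>a > 0\<close> the singularity at 0 makes the total mass infinite, hence the
  truncation; the factor \<open>\<bar>u\<bar>\<close> of the first moment cancels it.\<close>

definition tsd_density :: "real \<Rightarrow> real \<Rightarrow> real \<Rightarrow> real" where
  "tsd_density a l u = a / \<bar>u\<bar> * exp (- l * \<bar>u\<bar>)"

lemma tsd_density_measurable [measurable]: "tsd_density a l \<in> borel_measurable borel"
  unfolding tsd_density_def by measurable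

lemma tsd_density_minus [simp]: "tsd_density a l (- u) = tsd_density a l u"
  by (simp add: tsd_density_def)

lemma tsd_density_nonneg: "0 \<le> a \<Longrightarrow> 0 \<le> tsd_density a l u"
  by (simp add: tsd_density_def)

lemma integrable_tsd_density_moment:
  assumes "0 < l"
  shows "integrable lborel (\<lambda>u. \<bar>u\<bar> * tsd_density a l u)"
proof (rule Bochner_Integration.integrable_bound)
  have "integrable lborel (\<lambda>v::real. exp (- \<bar>v\<bar>))"
    using has_bochner_integral_abs_power_exp[of 0] by (auto dest: integrable.intros)
  from lborel_integrable_real_affine[OF this, of l 0]
  have "integrable lborel (\<lambda>u. exp (- \<bar>l * u\<bar>))"
    using assms by simp
  then show "integrable lborel (\<lambda>u. a * exp (- \<bar>l * u\<bar>))"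
    by simp
  show "AE u in lborel. norm (\<bar>u\<bar> * tsd_density a l u) \<le> norm (a * exp (- \<bar>l * u\<bar>))"
    using assms by (auto simp: tsd_density_def abs_mult)
qed simp

text \<open>The density is even, so adding the reflected integral turns the first difference into a
  second difference and accounts for the factor 2. Under \<open>u = v / l\<close> the Jacobian
  contributes \<open>1 / l\<close>, the density \<open>a * l / \<bar>v\<bar>\<close> and the second
  difference \<open>v\<^sup>2 / l\<^sup>2\<close>, together
  \<open>a * \<bar>v\<bar> / l\<^sup>2\<close>.\<close>

lemma integral_tsd_density_diff:
  fixes h :: "real \<Rightarrow> real"
  assumes "0 < l" and [measurable]: "h \<in> borel_measurable borel"
    and lip: "\<And>x y. \<bar>h x - h y\<bar> \<le> L * \<bar>x - y\<bar>"
  shows "2 * (LINT u|lborel. tsd_density a l u * (h (x + u) - h x))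
      = (LINT v|lborel. \<bar>v\<bar> * exp (- \<bar>v\<bar>) * (a / l\<^sup>2 * second_quotient h x (v / l)))"
proof -
  let ?f = "tsd_density a l"
  have int: "integrable lborel (\<lambda>u. ?f u * (h (x + c * u) - h x))" if "\<bar>c\<bar> = 1" for c
  proof (rule Bochner_Integration.integrable_bound)
    show "integrable lborel (\<lambda>u. L * (\<bar>u\<bar> * ?f u))"
      using integrable_tsd_density_moment[OF \<open>0 < l\<close>, of a] by simp
    show "AE u in lborel. norm (?f u * (h (x + c * u) - h x)) \<le> norm (L * (\<bar>u\<bar> * ?f u))"
    proof (rule AE_I2)
      fix u
      have "\<bar>h (x + c * u) - h x\<bar> \<le> L * \<bar>u\<bar>"
        using lip[of "x + c * u" x] that by (simp add: abs_mult)
      then have "\<bar>h (x + c * u) - h x\<bar> \<le> \<bar>L * \<bar>u\<bar>\<bar>"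
        by linarith
      from mult_right_mono[OF this abs_ge_zero[of "?f u"]]
      show "norm (?f u * (h (x + c * u) - h x)) \<le> norm (L * (\<bar>u\<bar> * ?f u))"
        by (simp add: abs_mult mult_ac)
    qed
  qed simp
  have reflect: "(LINT u|lborel. ?f u * (h (x + u) - h x)) = (LINT u|lborel. ?f u * (h (x - u) - h x))"
    using lborel_integral_real_affine[of "- 1" "\<lambda>u. ?f u * (h (x + u) - h x)" 0] by simp
  have "2 * (LINT u|lborel. ?f u * (h (x + u) - h x))
      = (LINT u|lborel. ?f u * (h (x + u) - h x)) + (LINT u|lborel. ?f u * (h (x - u) - h x))"
    using reflect by simp
  also have "\<dots> = (LINT u|lborel. ?f u * (h (x + u) + h (x - u) - 2 * h x))"
    using int[of 1] int[of "- 1"]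
    by (subst Bochner_Integration.integral_add[symmetric]) (simp_all add: algebra_simps)
  also have "\<dots> = (1 / l) * (LINT v|lborel. ?f (v / l) * (h (x + v / l) + h (x - v / l) - 2 * h x))"
    using lborel_integral_real_affine[of "1 / l" "\<lambda>u. ?f u * (h (x + u) + h (x - u) - 2 * h x)" 0] \<open>0 < l\<close>
    by simp
  also have "\<dots> = (LINT v|lborel. (1 / l) * (?f (v / l) * (h (x + v / l) + h (x - v / l) - 2 * h x)))"
    by (rule integral_mult_right_zero[symmetric])
  also have "\<dots> = (LINT v|lborel. \<bar>v\<bar> * exp (- \<bar>v\<bar>) * (a / l\<^sup>2 * second_quotient h x (v / l)))"
  proof (rule Bochner_Integration.integral_cong)
    fix v :: real
    show "(1 / l) * (?f (v / l) * (h (x + v / l) + h (x - v / l) - 2 * h x))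
        = \<bar>v\<bar> * exp (- \<bar>v\<bar>) * (a / l\<^sup>2 * second_quotient h x (v / l))"
    proof (cases "v = 0")
      case False
      define D where "D = h (x + v / l) + h (x - v / l) - 2 * h x"
      have f: "?f (v / l) = a * l / \<bar>v\<bar> * exp (- \<bar>v\<bar>)"
        using \<open>0 < l\<close> by (simp add: tsd_density_def abs_divide)
      have q: "second_quotient h x (v / l) = D * l\<^sup>2 / (\<bar>v\<bar> * \<bar>v\<bar>)"
        using \<open>0 < l\<close> by (simp add: second_quotient_def D_def power_divide flip: power2_eq_square)
      show ?thesis
        unfolding f q D_def[symmetric] using \<open>0 < l\<close> False by (simp add: field_simps)
    qed (simp add: second_quotient_def)
  qed simp
  finally show ?thesis .
qed

text \<open>The pointwise estimate is integrated against the weight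
  \<open>\<bar>v\<bar> * exp (- \<bar>v\<bar>)\<close>, whose mass is 2 and whose first absolute
  moment is 4. Halving, because of the factor 2 from symmetrisation, leaves the coefficients 1 and
  2/3.\<close>

lemma tsd_generator_diff_le:
  fixes h h1 h2 h3 :: "real \<Rightarrow> real"
  assumes d0: "\<And>x. (h has_real_derivative h1 x) (at x)"
    and d1: "\<And>x. (h1 has_real_derivative h2 x) (at x)"
    and d2: "\<And>x. (h2 has_real_derivative h3 x) (at x)"
    and b2: "\<And>x. \<bar>h2 x\<bar> \<le> 1" and b3: "\<And>x. \<bar>h3 x\<bar> \<le> 1"
    and lip: "\<And>x y. \<bar>h x - h y\<bar> \<le> L * \<bar>x - y\<bar>"
    and a1: "0 \<le> a1" and l1: "0 < l1" and l2: "0 < l2"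
  shows "\<bar>(LINT u|lborel. tsd_density a1 l1 u * (h (x + u) - h x))
      - (LINT u|lborel. tsd_density a2 l2 u * (h (x + u) - h x))\<bar>
    \<le> \<bar>a1 / l1\<^sup>2 - a2 / l2\<^sup>2\<bar> + 2 / 3 * (a1 / l1\<^sup>2) * \<bar>1 / l1 - 1 / l2\<bar>" (is "\<bar>?I1 - ?I2\<bar> \<le> _")
proof -
  let ?s1 = "a1 / l1\<^sup>2" and ?s2 = "a2 / l2\<^sup>2" and ?w = "\<lambda>v::real. \<bar>v\<bar> * exp (- \<bar>v\<bar>)"
  let ?q = "\<lambda>l v. second_quotient h x (v / l)"
  have [measurable]: "h \<in> borel_measurable borel"
    using d0 by (intro borel_measurable_continuous_onI continuous_at_imp_continuous_on)
      (auto intro: DERIV_isCont)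
  have m1: "has_bochner_integral lborel ?w 2"
    using has_bochner_integral_abs_power_exp[of 1] by simp
  have m2: "has_bochner_integral lborel (\<lambda>v::real. \<bar>v\<bar>\<^sup>2 * exp (- \<bar>v\<bar>)) 4"
    using has_bochner_integral_abs_power_exp[of 2] by simp
  have int: "integrable lborel (\<lambda>v. ?w v * (s * ?q l v))" for s l
  proof (rule Bochner_Integration.integrable_bound)
    show "integrable lborel (\<lambda>v. \<bar>s\<bar> * ?w v)"
      using m1 by (intro integrable_mult_right) (rule integrable.intros)
    have "\<bar>s\<bar> * \<bar>?q l v\<bar> \<le> \<bar>s\<bar> * 1" for v
      by (intro mult_left_mono second_quotient_le_1[OF d0 d1 d2 b2 b3]) simp
    then have "?w v * (\<bar>s\<bar> * \<bar>?q l v\<bar>) \<le> ?w v * (\<bar>s\<bar> * 1)" for v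
      by (rule mult_left_mono) simp
    then show "AE v in lborel. norm (?w v * (s * ?q l v)) \<le> norm (\<bar>s\<bar> * ?w v)"
      by (simp add: abs_mult mult_ac)
  qed (simp add: second_quotient_def)
  have "2 * (?I1 - ?I2) = (LINT v|lborel. ?w v * (?s1 * ?q l1 v)) - (LINT v|lborel. ?w v * (?s2 * ?q l2 v))"
    using integral_tsd_density_diff[OF l1 _ lip, of a1 x] integral_tsd_density_diff[OF l2 _ lip, of a2 x]
    by simp
  also have "\<dots> = (LINT v|lborel. ?w v * (?s1 * ?q l1 v - ?s2 * ?q l2 v))"
    using int[of ?s1 l1] int[of ?s2 l2]
    by (subst Bochner_Integration.integral_diff[symmetric]) (simp_all add: right_diff_distrib)
  finally have eq: "2 * (?I1 - ?I2) = \<dots>" .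
  let ?c = "?s1 * \<bar>1 / l1 - 1 / l2\<bar> / 3"
  have maj: "has_bochner_integral lborel (\<lambda>v. \<bar>?s1 - ?s2\<bar> * ?w v + ?c * (\<bar>v\<bar>\<^sup>2 * exp (- \<bar>v\<bar>))) (\<bar>?s1 - ?s2\<bar> * 2 + ?c * 4)"
    by (intro has_bochner_integral_add has_bochner_integral_mult_right m1 m2)
  have "\<bar>LINT v|lborel. ?w v * (?s1 * ?q l1 v - ?s2 * ?q l2 v)\<bar>
      \<le> (LINT v|lborel. \<bar>?w v * (?s1 * ?q l1 v - ?s2 * ?q l2 v)\<bar>)"
    by (rule integral_abs_bound)
  also have "\<dots> \<le> (LINT v|lborel. \<bar>?s1 - ?s2\<bar> * ?w v + ?c * (\<bar>v\<bar>\<^sup>2 * exp (- \<bar>v\<bar>)))"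
  proof (rule integral_mono)
    have "integrable lborel (\<lambda>v. ?w v * (?s1 * ?q l1 v) - ?w v * (?s2 * ?q l2 v))"
      by (intro Bochner_Integration.integrable_diff int)
    then show "integrable lborel (\<lambda>v. \<bar>?w v * (?s1 * ?q l1 v - ?s2 * ?q l2 v)\<bar>)"
      by (simp add: right_diff_distrib)
    show "integrable lborel (\<lambda>v. \<bar>?s1 - ?s2\<bar> * ?w v + ?c * (\<bar>v\<bar>\<^sup>2 * exp (- \<bar>v\<bar>)))"
      using maj by (rule integrable.intros)
    fix v :: real
    show "\<bar>?w v * (?s1 * ?q l1 v - ?s2 * ?q l2 v)\<bar> \<le> \<bar>?s1 - ?s2\<bar> * ?w v + ?c * (\<bar>v\<bar>\<^sup>2 * exp (- \<bar>v\<bar>))"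
    \<comment> \<open>The quotient estimate excludes \<open>v = 0\<close>, but there the weight
      vanishes.\<close>
    proof (cases "v = 0")
      case False
      have "\<bar>?w v * (?s1 * ?q l1 v - ?s2 * ?q l2 v)\<bar> = ?w v * \<bar>?s1 * ?q l1 v - ?s2 * ?q l2 v\<bar>"
        by (simp add: abs_mult)
      also have "\<dots> \<le> ?w v * (\<bar>?s1 - ?s2\<bar> + ?c * \<bar>v\<bar>)"
        using a1 False
        by (intro mult_left_mono scaled_second_quotient_diff_le[OF d0 d1 d2 b2 b3 l1 l2]) auto
      also have "\<dots> = \<bar>?s1 - ?s2\<bar> * ?w v + ?c * (\<bar>v\<bar>\<^sup>2 * exp (- \<bar>v\<bar>))"
        unfolding power2_eq_square by (simp only: algebra_simps)
      finally show ?thesis .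
    qed simp
  qed
  also have "\<dots> = \<bar>?s1 - ?s2\<bar> * 2 + ?c * 4"
    using maj by (rule has_bochner_integral_integral_eq)
  finally have "\<bar>2 * (?I1 - ?I2)\<bar> \<le> \<bar>?s1 - ?s2\<bar> * 2 + ?c * 4"
    unfolding eq .
  moreover have "\<bar>2 * (?I1 - ?I2)\<bar> = 2 * \<bar>?I1 - ?I2\<bar>"
    by (simp only: abs_mult abs_numeral)
  moreover have "\<bar>?s1 - ?s2\<bar> * 2 + ?c * 4 = 2 * (\<bar>?s1 - ?s2\<bar> + 2 / 3 * ?s1 * \<bar>1 / l1 - 1 / l2\<bar>)"
    by (simp only: distrib_left) simp
  ultimately show ?thesis
    by (simp only: mult_le_cancel_left_pos zero_less_numeral)
qed

section \<open>Passage to the stated bound\<close>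

text \<open>The right side is a difference of squares, and the extra factor
  \<open>a * (1 / a + 1 / b) = 1 + a / b\<close> is at least 1. This trades the reciprocals in the
  generator bound for the squared reciprocals of the theorem.\<close>

lemma abs_inverse_diff_le:
  fixes a b :: real
  assumes "0 < a" "0 < b"
  shows "\<bar>1 / a - 1 / b\<bar> \<le> a * \<bar>1 / a\<^sup>2 - 1 / b\<^sup>2\<bar>"
proof -
  have "a * \<bar>1 / a\<^sup>2 - 1 / b\<^sup>2\<bar> = (1 + a / b) * \<bar>1 / a - 1 / b\<bar>"
  proof -
    have "1 / a\<^sup>2 - 1 / b\<^sup>2 = (1 / a + 1 / b) * (1 / a - 1 / b)"
      by (simp add: algebra_simps power2_eq_square)
    then show ?thesis
      using assms by (simp add: abs_mult distrib_left flip: mult.assoc)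
  qed
  moreover have "1 * \<bar>1 / a - 1 / b\<bar> \<le> (1 + a / b) * \<bar>1 / a - 1 / b\<bar>"
    using assms by (intro mult_right_mono) auto
  ultimately show ?thesis by simp
qed

lemma smooth_test_functions_3D:
  assumes "h \<in> smooth_test_functions 3"
  obtains h1 h2 h3 where
    "\<And>x. (h has_real_derivative h1 x) (at x)" "\<And>x. (h1 has_real_derivative h2 x) (at x)"
    "\<And>x. (h2 has_real_derivative h3 x) (at x)"
    "\<And>x. \<bar>h x\<bar> \<le> 1" "\<And>x. \<bar>h1 x\<bar> \<le> 1" "\<And>x. \<bar>h2 x\<bar> \<le> 1" "\<And>x. \<bar>h3 x\<bar> \<le> 1"
proof -
  have D: "((deriv ^^ k) h has_real_derivative (deriv ^^ Suc k) h x) (at x)" if "k < 3" for k x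
    using assms that DERIV_deriv_iff_real_differentiable by (auto simp: smooth_test_functions_def)
  have B: "\<bar>(deriv ^^ k) h x\<bar> \<le> 1" if "k \<le> 3" for k x
    using assms that by (auto simp: smooth_test_functions_def)
  show ?thesis
    using D[of 0] D[of 1] D[of 2] B[of 0] B[of 1] B[of 2] B[of 3]
    by (intro that[of "(deriv ^^ 1) h" "(deriv ^^ 2) h" "(deriv ^^ 3) h"]) (simp_all add: eval_nat_numeral)
qed

text \<open>Provides the nonempty index set that \<open>cSUP_least\<close> requires.\<close>

lemma zero_in_smooth_test_functions: "(\<lambda>x. 0) \<in> smooth_test_functions r"
proof -
  have "(deriv ^^ k) (\<lambda>x. 0) = (\<lambda>x. 0 :: real)" for k
    by (induction k) simp_all
  then show ?thesis by (simp add: smooth_test_functions_def)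
qed

theorem theorem4p2:
  fixes M :: "'a measure" and N :: "'b measure"
    and X :: "'a \<Rightarrow> real" and Y :: "'b \<Rightarrow> real"
    and \<alpha>1 \<alpha>2 lam1 lam2 :: real
  assumes "prob_space M" and "prob_space N"
    and "0 < \<alpha>1" and "0 < \<alpha>2" and "0 < lam1" and "0 < lam2"
    and "has_sym_TSD M X \<alpha>1 lam1"
    and "has_sym_TSD N Y \<alpha>2 lam2"
    and "1 < lam1"
  shows "smooth_wasserstein 3 N Y M X \<le>
    lam1\<^sup>2 / (lam1\<^sup>2 - 1) *
      (\<bar>\<alpha>1 / lam1\<^sup>2 - \<alpha>2 / lam2\<^sup>2\<bar> +
       2 * (1 + \<alpha>1 / (3 * lam1)) * \<bar>1 / lam1\<^sup>2 - 1 / lam2\<^sup>2\<bar>)"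
proof -
  let ?f1 = "tsd_density \<alpha>1 lam1" and ?f2 = "tsd_density \<alpha>2 lam2"
  let ?P = "distr M borel X" and ?Q = "distr N borel Y"
  \<comment> \<open>One constant dominates both first absolute moments; the entry 1 makes it
    positive.\<close>
  define K where "K = max 1 (max (LINT u|lborel. \<bar>u\<bar> * ?f1 u) (LINT u|lborel. \<bar>u\<bar> * ?f2 u))"
  have f1: "levy_density ?f1 K" and f2: "levy_density ?f2 K"
    using assms by (auto simp: levy_density_def K_def integrable_tsd_density_moment intro!: tsd_density_nonneg)
  have [measurable]: "X \<in> borel_measurable M" "Y \<in> borel_measurable N"
    using assms by (auto simp: has_sym_TSD_def)
  have P: "real_distribution ?P" "char ?P z = exp (levy_density.exponent ?f1 z)"
    and Q: "real_distribution ?Q" "char ?Q z = exp (levy_density.exponent ?f2 z)" for z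
    using assms by (auto simp: has_sym_TSD_def sym_TSD_char_def tsd_density_def prob_space.real_distribution_distr)
  define w where "w = \<bar>1 / lam1\<^sup>2 - 1 / lam2\<^sup>2\<bar>"
  let ?T = "\<bar>\<alpha>1 / lam1\<^sup>2 - \<alpha>2 / lam2\<^sup>2\<bar> + 2 * (1 + \<alpha>1 / (3 * lam1)) * w"
  have "\<bar>(LINT \<omega>|N. h (Y \<omega>)) - (LINT \<omega>|M. h (X \<omega>))\<bar> \<le> ?T" if "h \<in> smooth_test_functions 3" for h
    using that
  proof (rule smooth_test_functions_3D)
    fix h1 h2 h3 :: "real \<Rightarrow> real"
    assume d: "\<And>x. (h has_real_derivative h1 x) (at x)" "\<And>x. (h1 has_real_derivative h2 x) (at x)"
        "\<And>x. (h2 has_real_derivative h3 x) (at x)"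
      and b: "\<And>x. \<bar>h x\<bar> \<le> 1" "\<And>x. \<bar>h1 x\<bar> \<le> 1" "\<And>x. \<bar>h2 x\<bar> \<le> 1" "\<And>x. \<bar>h3 x\<bar> \<le> 1"
    have lip: "\<bar>h x - h y\<bar> \<le> 1 * \<bar>x - y\<bar>" for x y
      using field_differentiable_bound[of UNIV h h1 1 x y] d(1) b(2) by simp
    have [measurable]: "h \<in> borel_measurable borel"
      using d(1) by (intro borel_measurable_continuous_onI continuous_at_imp_continuous_on)
        (auto intro: DERIV_isCont)
    have "\<bar>(LINT u|?P. h u) - (LINT u|?Q. h u)\<bar>
        \<le> \<bar>\<alpha>1 / lam1\<^sup>2 - \<alpha>2 / lam2\<^sup>2\<bar> + 2 / 3 * (\<alpha>1 / lam1\<^sup>2) * \<bar>1 / lam1 - 1 / lam2\<bar>"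
      using assms
      by (intro levy_density_integral_diff_le[OF f1 f2 P Q b(1) lip]
          tsd_generator_diff_le[OF d b(3,4) lip]) auto
    \<comment> \<open>With \<open>a = lam1\<close> in \<open>abs_inverse_diff_le\<close>, one power
      of \<open>lam1\<close> cancels and the coefficient becomes
      \<open>2 * (\<alpha>1 / (3 * lam1))\<close>.\<close>
    also have "2 / 3 * (\<alpha>1 / lam1\<^sup>2) * \<bar>1 / lam1 - 1 / lam2\<bar> \<le> 2 / 3 * (\<alpha>1 / lam1\<^sup>2) * (lam1 * w)"
      unfolding w_def using assms by (intro mult_left_mono abs_inverse_diff_le) auto
    also have "\<dots> = 2 * (\<alpha>1 / (3 * lam1)) * w"
      using assms by (simp add: field_simps power2_eq_square)
    also have "\<dots> \<le> 2 * (1 + \<alpha>1 / (3 * lam1)) * w"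
      by (intro mult_right_mono) (simp_all add: w_def)
    finally show ?thesis
      by (simp add: integral_distr abs_minus_commute)
  qed
  then have "smooth_wasserstein 3 N Y M X \<le> ?T"
    unfolding smooth_wasserstein_def using zero_in_smooth_test_functions[of 3]
    by (intro cSUP_least) auto
  \<comment> \<open>Since \<open>lam1 > 1\<close>, the denominator \<open>lam1\<^sup>2 - 1\<close>
    is positive and the prefactor is at least 1.\<close>
  also have "1 * ?T \<le> lam1\<^sup>2 / (lam1\<^sup>2 - 1) * ?T"
  proof (rule mult_right_mono)
    have "1 < lam1\<^sup>2"
      using \<open>1 < lam1\<close> by (simp add: power2_eq_square less_1_mult)
    then show "1 \<le> lam1\<^sup>2 / (lam1\<^sup>2 - 1)"
      by (simp add: field_simps)
    show "0 \<le> ?T"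
      using assms by (simp add: w_def)
  qed
  finally show ?thesis
    unfolding w_def by simp
qed

end
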